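(* Let $K,N,T\ge1$ be integers and $\frac1K\le\mu\le1$. Let $\mathcal U=(\mathcal U_1,\ldots,\mathcal U_K)$ be any dataset placement with $|\mathcal U_k|\le\mu N$ for all $k$, and consider any valid shuffling scheme for $\mathcal U$ with parameters $(K,N,T)$, with uplink load $L_u$ and downlink load $L_d$. Then $$L_u\ge \mathrm{Conv}_u(\mu),\qquad L_d\ge\mathrm{Conv}_d(\mu),$$ where $\mathrm{Conv}_u$ and $\mathrm{Conv}_d$ are the lower convex envelopes on $[\frac1K,1]$ of the point sets $\{(s,\frac1s-1): s\in\{\frac1K,\frac2K,\ldots,1\}\}$ and $\{(s,\frac{sK}{sK+1}(\frac1s-1)): s\in\{\frac1K,\frac2K,\ldots,1\}\}$, respectively. In particular, if $\mu K$ is an integer, then $L_u\ge\frac1\mu-1$ and $L_d\ge\frac{\mu K}{\mu K+1}\left(\frac1\mu-1\right)$.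
   Context: Wireless distributed computing model. There are $K$ users and a dataset of $N$ files indexed by $\{1,\ldots,N\}$. For each user $q\in\{1,\ldots,K\}$ and file $n\in\{1,\ldots,N\}$ there is an intermediate value $v_{q,n}\in\{0,1\}^T$ (the Map output for the input of user $q$ on file $n$). A dataset placement is a tuple $\mathcal U=(\mathcal U_1,\ldots,\mathcal U_K)$ of subsets of $\{1,\ldots,N\}$ whose union is $\{1,\ldots,N\}$; user $k$ stores the files in $\mathcal U_k$ and hence knows (exactly) the intermediate values $\{v_{q,n}: q\in\{1,\ldots,K\},\ n\in\mathcal U_k\}$. A valid shuffling scheme for $\mathcal U$ with parameters $(K,N,T)$ consists of: (a) uplink encoders $\psi_k$, $k=1,\ldots,K$, producing $W_k=\psi_k(\{v_{q,n}: q\in\{1,\ldots,K\}, n\in\mathcal U_k\})\in\{0,1\}^{\ell_k}$, sent by user $k$ to an access point (which has no dataset access); (b) an access-point encoder $\rho$ producing $X=\rho(W_1,\ldots,W_K)\in\{0,1\}^{\ell}$, broadcast to all users; (c) for each user $k$ a decoder that, from $X$ and $\{v_{q,n}: q\in\{1,\ldots,K\},n\in\mathcal U_k\}$, recovers $(v_{k,1},\ldots,v_{k,N})$, for every possible array $(v_{q,n})\in(\{0,1\}^T)^{KN}$. Encoders and decoders may depend on $\mathcal U$ and may be arbitrary functions. The uplink communication load is $L_u=\frac{1}{NT}\sum_{k=1}^K\ell_k$ and the downlink communication load is $L_d=\frac{\ell}{NT}$. The lower convex envelope of a finite set of points $(s,f(s))$ is the largest convex function on the interval spanned by the $s$'s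 that is at most $f(s)$ at each of the points. *)

theory Defs
  imports "HOL-Analysis.Analysis"
begin

section \<open>Shuffling schemes for wireless distributed computing\<close>

definition bits :: "nat \<Rightarrow> bool list set" where
  "bits m = {w. length w = m}"

definition dataset_placement :: "nat \<Rightarrow> nat \<Rightarrow> (nat \<Rightarrow> nat set) \<Rightarrow> bool" where
  "dataset_placement K N U \<longleftrightarrow>
     (\<forall>k\<in>{1..K}. U k \<subseteq> {1..N}) \<and> (\<Union>k\<in>{1..K}. U k) = {1..N}"

text \<open>
  An array of intermediate values on the files in \<open>A\<close> maps \<open>(q, n)\<close> to \<open>v\<^bsub>q,n\<^esub>\<close>, and is
  \<^const>\<open>undefined\<close> outside \<open>{1..K} \<times> A\<close>. What a user storing the files \<open>A\<close> knows is therefore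
  exactly the restriction of the full array to \<open>{1..K} \<times> A\<close>.
\<close>

type_synonym iv_array = "nat \<times> nat \<Rightarrow> bool list"

definition iv_arrays :: "nat \<Rightarrow> nat \<Rightarrow> nat set \<Rightarrow> iv_array set" where
  "iv_arrays K T A = {1..K} \<times> A \<rightarrow>\<^sub>E bits T"

definition known_values :: "nat \<Rightarrow> nat set \<Rightarrow> iv_array \<Rightarrow> iv_array" where
  "known_values K A v = restrict v ({1..K} \<times> A)"

definition uplink_messages ::
  "nat \<Rightarrow> (nat \<Rightarrow> nat set) \<Rightarrow> (nat \<Rightarrow> iv_array \<Rightarrow> bool list) \<Rightarrow> iv_array \<Rightarrow> nat \<Rightarrow> bool list" where
  "uplink_messages K U \<psi> v = (\<lambda>k\<in>{1..K}. \<psi> k (known_values K (U k) v))"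

text \<open>
  \<open>\<psi> k\<close> is the uplink encoder of user \<open>k\<close>, with \<open>lu k\<close> output bits; \<open>\<rho>\<close> is the encoder of the
  access point, with \<open>ld\<close> output bits; \<open>\<delta> k\<close> is the decoder of user \<open>k\<close>, whose value is
  read as a sequence indexed by the files.
\<close>

definition valid_shuffling_scheme ::
  "nat \<Rightarrow> nat \<Rightarrow> nat \<Rightarrow> (nat \<Rightarrow> nat set) \<Rightarrow>
   (nat \<Rightarrow> nat) \<Rightarrow> (nat \<Rightarrow> iv_array \<Rightarrow> bool list) \<Rightarrow>
   nat \<Rightarrow> ((nat \<Rightarrow> bool list) \<Rightarrow> bool list) \<Rightarrow>
   (nat \<Rightarrow> bool list \<Rightarrow> iv_array \<Rightarrow> nat \<Rightarrow> bool list) \<Rightarrow> bool" where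
  "valid_shuffling_scheme K N T U lu \<psi> ld \<rho> \<delta> \<longleftrightarrow>
     (\<forall>k\<in>{1..K}. \<psi> k \<in> iv_arrays K T (U k) \<rightarrow> bits (lu k)) \<and>
     \<rho> \<in> (\<Pi>\<^sub>E k\<in>{1..K}. bits (lu k)) \<rightarrow> bits ld \<and>
     (\<forall>v\<in>iv_arrays K T {1..N}. \<forall>k\<in>{1..K}. \<forall>n\<in>{1..N}.
        \<delta> k (\<rho> (uplink_messages K U \<psi> v)) (known_values K (U k) v) n = v (k, n))"

definition uplink_load :: "nat \<Rightarrow> nat \<Rightarrow> nat \<Rightarrow> (nat \<Rightarrow> nat) \<Rightarrow> real" where
  "uplink_load K N T lu = 1 / (real N * real T) * (\<Sum>k=1..K. real (lu k))"

definition downlink_load :: "nat \<Rightarrow> nat \<Rightarrow> nat \<Rightarrow> real" where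
  "downlink_load N T ld = real ld / (real N * real T)"


section \<open>Lower convex envelopes\<close>

definition spanned_interval :: "(real \<times> real) set \<Rightarrow> real set" where
  "spanned_interval P = {Min (fst ` P)..Max (fst ` P)}"

definition convex_minorants :: "(real \<times> real) set \<Rightarrow> (real \<Rightarrow> real) set" where
  "convex_minorants P =
     {g. convex_on (spanned_interval P) g \<and> (\<forall>(s, y)\<in>P. g s \<le> y)}"

text \<open>
  The largest convex minorant is the pointwise supremum of all of them; that this supremum is
  finite and attained by a convex minorant is shown below. Values outside
  \<open>spanned_interval P\<close> are meaningless.
\<close>

definition lower_convex_envelope :: "(real \<times> real) set \<Rightarrow> real \<Rightarrow> real" where
  "lower_convex_envelope P x = (SUP g\<in>convex_minorants P. g x)"

lemma convex_minorants_nonempty: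
  assumes "finite P"
  shows "convex_minorants P \<noteq> {}"
proof -
  have "(\<lambda>_. Min (snd ` P)) \<in> convex_minorants P"
    using assms by (auto simp: convex_minorants_def spanned_interval_def convex_on_const
        intro!: Min_le image_eqI[where f = snd])
  then show ?thesis by blast
qed

lemma convex_minorants_bdd_above:
  assumes "finite P" "P \<noteq> {}" "x \<in> spanned_interval P"
  shows "bdd_above ((\<lambda>g. g x) ` convex_minorants P)"
proof (rule bdd_aboveI2)
  let ?a = "Min (fst ` P)" and ?b = "Max (fst ` P)"
  fix g assume g: "g \<in> convex_minorants P"
  have "?a \<in> fst ` P" "?b \<in> fst ` P"
    using assms by (auto intro!: Min_in Max_in)
  then obtain p q where pq: "p \<in> P" "q \<in> P" "fst p = ?a" "fst q = ?b"
    by (metis imageE)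
  have le: "g (fst r) \<le> Max (snd ` P)" if "r \<in> P" for r
  proof -
    have "g (fst r) \<le> snd r"
      using g that by (force simp: convex_minorants_def)
    also have "\<dots> \<le> Max (snd ` P)"
      using that assms by auto
    finally show ?thesis .
  qed
  have ab: "x \<in> {?a..?b}" using assms by (simp add: spanned_interval_def)
  have "x \<in> closed_segment ?a ?b"
    using ab by (auto simp: closed_segment_eq_real_ivl)
  then obtain u where u: "0 \<le> u" "u \<le> 1" "x = (1 - u) *\<^sub>R ?a + u *\<^sub>R ?b"
    by (auto simp: in_segment)
  have "g x \<le> (1 - u) * g ?a + u * g ?b"
    unfolding u(3)
    by (rule convex_onD[of "{?a..?b}" g])
      (use g u ab in \<open>auto simp: convex_minorants_def spanned_interval_def\<close>)
  also have "\<dots> \<le> (1 - u) * Max (snd ` P) + u * Max (snd ` P)"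
    using le[OF pq(1)] le[OF pq(2)] pq u by (intro add_mono mult_left_mono) auto
  finally show "g x \<le> Max (snd ` P)" by (simp add: algebra_simps)
qed

lemma lower_convex_envelope_upper:
  assumes "finite P" "P \<noteq> {}" "g \<in> convex_minorants P" "x \<in> spanned_interval P"
  shows "g x \<le> lower_convex_envelope P x"
  unfolding lower_convex_envelope_def
  by (rule cSUP_upper[OF assms(3) convex_minorants_bdd_above]) (use assms in auto)

lemma lower_convex_envelope_minorant:
  assumes "finite P" "P \<noteq> {}"
  shows "lower_convex_envelope P \<in> convex_minorants P"
proof -
  let ?I = "spanned_interval P" and ?L = "lower_convex_envelope P"
  have "convex_on ?I ?L"
  proof (rule convex_onI)
    fix t x y :: real
    assume t: "0 < t" "t < 1" and xy: "x \<in> ?I" "y \<in> ?I"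
    show "?L ((1 - t) *\<^sub>R x + t *\<^sub>R y) \<le> (1 - t) * ?L x + t * ?L y"
      unfolding lower_convex_envelope_def[of P "(1 - t) *\<^sub>R x + t *\<^sub>R y"]
    proof (rule cSUP_least[OF convex_minorants_nonempty[OF assms(1)]])
      fix g assume g: "g \<in> convex_minorants P"
      have "g ((1 - t) *\<^sub>R x + t *\<^sub>R y) \<le> (1 - t) * g x + t * g y"
        using g t xy by (intro convex_onD[of ?I g]) (auto simp: convex_minorants_def)
      also have "\<dots> \<le> (1 - t) * ?L x + t * ?L y"
        using t by (intro add_mono mult_left_mono lower_convex_envelope_upper assms g xy) auto
      finally show "g ((1 - t) *\<^sub>R x + t *\<^sub>R y) \<le> (1 - t) * ?L x + t * ?L y" .
    qed
  qed (simp add: spanned_interval_def)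
  moreover have "?L s \<le> y" if "(s, y) \<in> P" for s y
    unfolding lower_convex_envelope_def
    by (rule cSUP_least[OF convex_minorants_nonempty[OF assms(1)]])
      (use that in \<open>auto simp: convex_minorants_def\<close>)
  ultimately show ?thesis by (auto simp: convex_minorants_def)
qed


definition storage_grid :: "nat \<Rightarrow> real set" where
  "storage_grid K = (\<lambda>i. real i / real K) ` {1..K}"

lemma spanned_interval_storage_grid:
  assumes "K \<ge> 1"
  shows "spanned_interval ((\<lambda>s. (s, f s)) ` storage_grid K) = {1 / real K..1}"
proof -
  have "Min (storage_grid K) = 1 / real K"
    using assms by (intro Min_eqI) (force simp: storage_grid_def divide_right_mono)+
  moreover have "Max (storage_grid K) = 1"
    using assms by (intro Max_eqI) (force simp: storage_grid_def)+
  ultimately show ?thesis by (simp add: spanned_interval_def image_image)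
qed

definition Conv_u :: "nat \<Rightarrow> real \<Rightarrow> real" where
  "Conv_u K = lower_convex_envelope ((\<lambda>s. (s, 1 / s - 1)) ` storage_grid K)"

definition Conv_d :: "nat \<Rightarrow> real \<Rightarrow> real" where
  "Conv_d K = lower_convex_envelope
     ((\<lambda>s. (s, s * real K / (s * real K + 1) * (1 / s - 1))) ` storage_grid K)"

end

theory Submission
  imports Defs
begin

text \<open>
  Take the array of intermediate values uniformly at random. For a set \<open>S\<close> of users let \<open>H(S)\<close> be
  the entropy of what is transmitted, given everything that the users outside \<open>S\<close> store or
  demand. Revealing in addition the storage of a user \<open>k \<in> S\<close> lets \<open>k\<close> decode its demand, hence
  that conditional entropy is \<open>T\<close> times the number of files stored only within \<open>S - {k}\<close>, plus
  \<open>H(S - {k})\<close>. For the downlink, averaging over \<open>k\<close> gives a recursion for \<open>H(S)\<close> with factor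
  \<open>card S\<close>; for the uplink, message \<open>k\<close> is determined by the storage of \<open>k\<close>, and subadditivity over
  the messages improves the factor to \<open>card S - 1\<close>. Solving the recursions, a file stored by exactly
  \<open>j\<close> users contributes \<open>T (K - j) / j\<close> to the uplink and \<open>T (K - j) / (j + 1)\<close> to the downlink.
  The average of \<open>j / K\<close> over the files is at most \<open>\<mu>\<close>, and Jensen's inequality for the
  (decreasing) envelopes finishes the proof.
\<close>

section \<open>Entropy of functions on a finite set\<close>

text \<open>
  The average of the logarithm of the fiber size is the conditional entropy of a uniformly random
  point of \<open>A\<close> given its image under \<open>f\<close>; the entropy of \<open>f\<close> itself is
  \<open>log 2 (card A) - residual_entropy A f\<close>.
\<close>

definition fiber :: "'a set \<Rightarrow> ('a \<Rightarrow> 'b) \<Rightarrow> 'a \<Rightarrow> 'a set" where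
  "fiber A f x = {y \<in> A. f y = f x}"

definition residual_entropy :: "'a set \<Rightarrow> ('a \<Rightarrow> 'b) \<Rightarrow> real" where
  "residual_entropy A f = (\<Sum>x\<in>A. log 2 (real (card (fiber A f x)))) / real (card A)"

text \<open>The entropy of the pair \<open>(f, g)\<close> minus that of \<open>g\<close>: the terms
  \<open>log 2 (card A)\<close> cancel, which reverses the order of the difference.\<close>

definition cond_entropy :: "'a set \<Rightarrow> ('a \<Rightarrow> 'b) \<Rightarrow> ('a \<Rightarrow> 'c) \<Rightarrow> real" where
  "cond_entropy A f g = residual_entropy A g - residual_entropy A (\<lambda>x. (f x, g x))"

lemma card_fiber_pos: "finite A \<Longrightarrow> x \<in> A \<Longrightarrow> 0 < card (fiber A f x)"
  by (auto simp: fiber_def card_gt_0_iff)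

text \<open>The fibers of \<open>f\<close> lie inside those of \<open>g\<close>. The implication in
  the hypothesis expresses that \<open>g\<close> is a function of \<open>f\<close> on
  \<open>A\<close>; this form recurs below.\<close>

lemma residual_entropy_mono:
  assumes "finite A" "\<And>x y. x \<in> A \<Longrightarrow> y \<in> A \<Longrightarrow> f x = f y \<Longrightarrow> g x = g y"
  shows "residual_entropy A f \<le> residual_entropy A g"
  unfolding residual_entropy_def
proof (intro divide_right_mono sum_mono)
  fix x assume x: "x \<in> A"
  have "card (fiber A f x) \<le> card (fiber A g x)"
  proof (rule card_mono)
    show "fiber A f x \<subseteq> fiber A g x"
      unfolding fiber_def using assms(2) x by blast
  qed (simp add: fiber_def assms(1))
  then show "log 2 (card (fiber A f x)) \<le> log 2 (card (fiber A g x))"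
    using card_fiber_pos[OF assms(1) x, of f] by simp
qed simp

lemma residual_entropy_cong:
  assumes "finite A" "\<And>x y. x \<in> A \<Longrightarrow> y \<in> A \<Longrightarrow> f x = f y \<longleftrightarrow> g x = g y"
  shows "residual_entropy A f = residual_entropy A g"
  by (intro antisym residual_entropy_mono assms(1)) (use assms(2) in blast)+

text \<open>Jensen's inequality for the logarithm, normalized to mean at most 1; it reduces to the
  tangent bound \<open>ln r \<le> r - 1\<close>.\<close>

lemma sum_log2_le:
  assumes "finite A" "\<And>x. x \<in> A \<Longrightarrow> 0 < r x" "(\<Sum>x\<in>A. r x) \<le> real (card A)"
  shows "(\<Sum>x\<in>A. log 2 (r x)) \<le> 0"
proof -
  have "(\<Sum>x\<in>A. log 2 (r x)) \<le> (\<Sum>x\<in>A. (r x - 1) / ln 2)"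
    using assms(2) by (intro sum_mono) (auto simp: log_def intro!: divide_right_mono ln_le_minus_one)
  also have "\<dots> = ((\<Sum>x\<in>A. r x) - real (card A)) / ln 2"
    by (simp add: sum_divide_distrib[symmetric] sum_subtractf)
  also have "\<dots> \<le> 0"
    using assms(3) by (intro divide_nonpos_pos) auto
  finally show ?thesis .
qed

text \<open>The two fiber sizes in the numerator count pairs \<open>x\<close>, \<open>y\<close> that
  agree with \<open>w\<close> under \<open>a\<close> and \<open>b\<close> respectively. Exchanging
  sums, each pair \<open>(x, y)\<close> receives at most the reciprocal size of the
  \<open>m\<close>-fiber of \<open>x\<close>, and nothing unless \<open>m x = m y\<close>. Summing
  over \<open>y\<close> then gives at most 1 for each \<open>x\<close>.\<close>

lemma sum_fiber_quotient:
  assumes A: "finite A"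
    and am: "\<And>x y. x \<in> A \<Longrightarrow> y \<in> A \<Longrightarrow> a x = a y \<Longrightarrow> m x = m y"
    and bm: "\<And>x y. x \<in> A \<Longrightarrow> y \<in> A \<Longrightarrow> b x = b y \<Longrightarrow> m x = m y"
  defines "ab \<equiv> \<lambda>x. (a x, b x)"
  shows "(\<Sum>w\<in>A. real (card (fiber A a w)) * real (card (fiber A b w)) /
            (real (card (fiber A ab w)) * real (card (fiber A m w)))) \<le> real (card A)"
proof -
  let ?c = "\<lambda>w. real (card (fiber A ab w)) * real (card (fiber A m w))"
  have card: "real (card (fiber A f w)) = (\<Sum>x\<in>A. of_bool (f x = f w))"
    for f :: "'a \<Rightarrow> 'x" and w
    using A by (simp add: fiber_def of_bool_def sum.If_cases Int_def)
  have "(\<Sum>w\<in>A. real (card (fiber A a w)) * real (card (fiber A b w)) / ?c w)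
      = (\<Sum>w\<in>A. \<Sum>x\<in>A. \<Sum>y\<in>A. of_bool (a x = a w) * of_bool (b y = b w) / ?c w)"
    unfolding card[of a] card[of b] sum_product by (simp add: sum_divide_distrib)
  also have "\<dots> = (\<Sum>x\<in>A. \<Sum>w\<in>A. \<Sum>y\<in>A. of_bool (a x = a w) * of_bool (b y = b w) / ?c w)"
    by (rule sum.swap)
  also have "\<dots> = (\<Sum>x\<in>A. \<Sum>y\<in>A. \<Sum>w\<in>A. of_bool (a x = a w) * of_bool (b y = b w) / ?c w)"
    by (intro sum.cong refl sum.swap)
  also have "\<dots> \<le> (\<Sum>x\<in>A. \<Sum>y\<in>A. of_bool (m y = m x) / real (card (fiber A m x)))"
  proof (intro sum_mono)
    fix x y assume xy: "x \<in> A" "y \<in> A"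
    show "(\<Sum>w\<in>A. of_bool (a x = a w) * of_bool (b y = b w) / ?c w)
        \<le> of_bool (m y = m x) / real (card (fiber A m x))"
    proof (cases "\<exists>z\<in>A. a x = a z \<and> b y = b z")
      case False
      then have "(\<Sum>w\<in>A. of_bool (a x = a w) * of_bool (b y = b w) / ?c w) = 0"
        by (intro sum.neutral) auto
      then show ?thesis by simp
    next
      case True
      then obtain z where z: "z \<in> A" "a x = a z" "b y = b z" by blast
      have m: "m x = m z" "m y = m z" using am bm xy z by blast+
      \<comment> \<open>The contributing \<open>w\<close> form a single fiber of \<open>ab\<close>,
        on which the weight is constant, so the size of that fiber cancels.\<close>
      have "(\<Sum>w\<in>A. of_bool (a x = a w) * of_bool (b y = b w) / ?c w)
          = (\<Sum>w\<in>fiber A ab z. 1 / ?c z)"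
      proof (rule sum.mono_neutral_cong_right)
        fix w assume w: "w \<in> fiber A ab z"
        then have "ab w = ab z" "w \<in> A" by (auto simp: fiber_def)
        moreover have "m w = m z"
          using am[of w z] calculation z by (simp add: ab_def)
        ultimately show "of_bool (a x = a w) * of_bool (b y = b w) / ?c w = 1 / ?c z"
          using z by (simp add: fiber_def ab_def)
      qed (use A z in \<open>auto simp: fiber_def ab_def\<close>)
      also have "\<dots> = 1 / real (card (fiber A m x))"
        using card_fiber_pos[OF A z(1), of ab] m by (simp add: fiber_def)
      finally show ?thesis using m by simp
    qed
  qed
  also have "\<dots> = (\<Sum>x\<in>A. 1)"
  proof (rule sum.cong[OF refl])
    fix x assume x: "x \<in> A"
    show "(\<Sum>y\<in>A. of_bool (m y = m x) / real (card (fiber A m x))) = 1"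
      using card_fiber_pos[OF A x, of m] by (simp add: sum_divide_distrib[symmetric] card[symmetric])
  qed
  finally show ?thesis by simp
qed

text \<open>Submodularity of entropy, from Jensen's inequality applied to the quotients above.
  Allowing any \<open>e\<close> determined by the pair \<open>(a, b)\<close> makes it applicable to
  other encodings of the joint information.\<close>

lemma residual_entropy_submodular:
  assumes A: "finite A"
    and am: "\<And>x y. x \<in> A \<Longrightarrow> y \<in> A \<Longrightarrow> a x = a y \<Longrightarrow> m x = m y"
    and bm: "\<And>x y. x \<in> A \<Longrightarrow> y \<in> A \<Longrightarrow> b x = b y \<Longrightarrow> m x = m y"
    and e: "\<And>x y. x \<in> A \<Longrightarrow> y \<in> A \<Longrightarrow> a x = a y \<Longrightarrow> b x = b y \<Longrightarrow> e x = e y"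
  shows "residual_entropy A a + residual_entropy A b \<le> residual_entropy A e + residual_entropy A m"
proof -
  let ?ab = "\<lambda>x. (a x, b x)"
  let ?l = "\<lambda>w. log 2 (card (fiber A a w)) + log 2 (card (fiber A b w))
              - log 2 (card (fiber A ?ab w)) - log 2 (card (fiber A m w))"
  have "(\<Sum>w\<in>A. ?l w) = (\<Sum>w\<in>A. log 2 (real (card (fiber A a w)) * real (card (fiber A b w)) /
            (real (card (fiber A ?ab w)) * real (card (fiber A m w)))))"
    using A by (intro sum.cong refl) (simp add: log_mult log_divide card_fiber_pos)
  also have "\<dots> \<le> 0"
  proof (rule sum_log2_le[OF A _ sum_fiber_quotient[OF A am bm]])
    show "0 < real (card (fiber A a w)) * real (card (fiber A b w)) /
        (real (card (fiber A ?ab w)) * real (card (fiber A m w)))" if "w \<in> A" for w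
      using A that by (simp add: card_fiber_pos)
  qed
  finally have "(\<Sum>w\<in>A. ?l w) / card A \<le> 0"
    by (simp add: divide_nonpos_nonneg)
  then have "residual_entropy A a + residual_entropy A b
      \<le> residual_entropy A ?ab + residual_entropy A m"
    by (simp add: residual_entropy_def sum.distrib sum_subtractf diff_divide_distrib add_divide_distrib)
  also have "residual_entropy A ?ab \<le> residual_entropy A e"
    by (rule residual_entropy_mono[OF A]) (use e in blast)
  finally show ?thesis by simp
qed

section \<open>Rules for conditional entropy\<close>

lemma cond_entropy_nonneg: "finite A \<Longrightarrow> 0 \<le> cond_entropy A f g"
  unfolding cond_entropy_def diff_ge_0_iff_ge by (rule residual_entropy_mono) auto

text \<open>Further conditioning cannot increase entropy: submodularity for \<open>(f, g)\<close>
  and \<open>g'\<close>, with common part \<open>g\<close>.\<close>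

lemma cond_entropy_antimono:
  assumes "finite A" "\<And>x y. x \<in> A \<Longrightarrow> y \<in> A \<Longrightarrow> g' x = g' y \<Longrightarrow> g x = g y"
  shows "cond_entropy A f g' \<le> cond_entropy A f g"
proof -
  have "residual_entropy A (\<lambda>x. (f x, g x)) + residual_entropy A g'
      \<le> residual_entropy A (\<lambda>x. (f x, g' x)) + residual_entropy A g"
    by (rule residual_entropy_submodular[OF assms(1)]) (use assms(2) in blast)+
  then show ?thesis by (simp add: cond_entropy_def)
qed

lemma cond_entropy_chain:
  assumes "finite A" "\<And>x y. x \<in> A \<Longrightarrow> y \<in> A \<Longrightarrow> f x = f y \<Longrightarrow> h x = h y"
  shows "cond_entropy A f g = cond_entropy A h g + cond_entropy A f (\<lambda>x. (h x, g x))"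
proof -
  have "residual_entropy A (\<lambda>x. (f x, g x)) = residual_entropy A (\<lambda>x. (f x, h x, g x))"
    by (rule residual_entropy_cong[OF assms(1)]) (use assms(2) in blast)
  then show ?thesis by (simp add: cond_entropy_def)
qed

text \<open>Subadditivity: each insertion is an instance of submodularity with common part
  \<open>g\<close>.\<close>

lemma cond_entropy_restrict_le_sum:
  assumes A: "finite A" and B: "finite B"
  shows "cond_entropy A (\<lambda>x. restrict (W x) B) g \<le> (\<Sum>k\<in>B. cond_entropy A (\<lambda>x. W x k) g)"
  using B
proof (induction B)
  case empty
  have "residual_entropy A (\<lambda>x. (restrict (W x) {}, g x)) = residual_entropy A g"
    by (rule residual_entropy_cong[OF A]) auto
  then show ?case
    unfolding cond_entropy_def by (simp only: sum.empty diff_self order_refl)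
next
  case (insert k B)
  have "cond_entropy A (\<lambda>x. restrict (W x) (insert k B)) g
      \<le> cond_entropy A (\<lambda>x. W x k) g + cond_entropy A (\<lambda>x. restrict (W x) B) g"
  proof -
    have "residual_entropy A (\<lambda>x. (W x k, g x)) + residual_entropy A (\<lambda>x. (restrict (W x) B, g x))
        \<le> residual_entropy A (\<lambda>x. (restrict (W x) (insert k B), g x)) + residual_entropy A g"
    proof (rule residual_entropy_submodular[OF A])
      fix x y assume *: "(W x k, g x) = (W y k, g y)" "(restrict (W x) B, g x) = (restrict (W y) B, g y)"
      have "W x i = W y i" if "i \<in> insert k B" for i
        using that * by (metis Pair_inject insert_iff restrict_apply')
      then show "(restrict (W x) (insert k B), g x) = (restrict (W y) (insert k B), g y)"
        using *(1) by (auto intro: restrict_ext)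
    qed auto
    then show ?thesis by (simp add: cond_entropy_def)
  qed
  then show ?case
    using insert.IH unfolding sum.insert[OF insert.hyps] by linarith
qed

text \<open>Entropy is at most the logarithm of the number of values. The reciprocal fiber sizes sum
  to 1 over each fiber, hence to the number of values over \<open>A\<close>, and Jensen's inequality
  applies.\<close>

lemma log2_card_minus_residual_entropy_le:
  assumes A: "finite A" "A \<noteq> {}"
  shows "log 2 (card A) - residual_entropy A f \<le> log 2 (card (f ` A))"
proof -
  let ?R = "real (card (f ` A))" and ?N = "real (card A)"
  have pos: "?R > 0" "?N > 0" using A by (auto simp: card_gt_0_iff)
  have "(\<Sum>x\<in>A. 1 / real (card (fiber A f x))) = (\<Sum>y\<in>f ` A. \<Sum>x | x \<in> A \<and> f x = y. 1 / real (card (fiber A f x)))"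
    by (rule sum.image_gen[OF A(1)])
  also have "\<dots> = (\<Sum>y\<in>f ` A. 1)"
  proof (rule sum.cong[OF refl])
    fix y assume "y \<in> f ` A"
    then obtain z where z: "z \<in> A" "y = f z" by blast
    have "(\<Sum>x | x \<in> A \<and> f x = y. 1 / real (card (fiber A f x)))
        = (\<Sum>x\<in>fiber A f z. 1 / real (card (fiber A f z)))"
      using z by (intro sum.cong) (auto simp: fiber_def)
    then show "(\<Sum>x | x \<in> A \<and> f x = y. 1 / real (card (fiber A f x))) = 1"
      using card_fiber_pos[OF A(1) z(1), of f] by simp
  qed
  finally have inv: "(\<Sum>x\<in>A. 1 / real (card (fiber A f x))) = ?R" by simp
  have "(\<Sum>x\<in>A. log 2 ?N - log 2 (card (fiber A f x)) - log 2 ?R)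
      = (\<Sum>x\<in>A. log 2 (?N / (card (fiber A f x) * ?R)))"
    using A pos by (intro sum.cong refl) (simp add: log_mult log_divide card_fiber_pos)
  also have "\<dots> \<le> 0"
  proof (rule sum_log2_le[OF A(1)])
    have "(\<Sum>x\<in>A. ?N / (card (fiber A f x) * ?R)) = ?N / ?R * (\<Sum>x\<in>A. 1 / real (card (fiber A f x)))"
      by (simp add: sum_distrib_left mult.commute)
    then show "(\<Sum>x\<in>A. ?N / (card (fiber A f x) * ?R)) \<le> ?N"
      using pos by (simp add: inv)
  qed (use A pos in \<open>auto simp: card_fiber_pos\<close>)
  finally have "(\<Sum>x\<in>A. log 2 ?N - log 2 (card (fiber A f x)) - log 2 ?R) / ?N \<le> 0"
    using pos by (simp add: divide_nonpos_pos)
  then show ?thesis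
    using pos by (simp add: residual_entropy_def sum_subtractf diff_divide_distrib)
qed

text \<open>Each fiber is a product with singleton factors on \<open>D\<close> and full factors
  \<open>B\<close> elsewhere, so all fibers have equal size.\<close>

lemma residual_entropy_coordinates:
  assumes "finite I" "D \<subseteq> I" "finite B" "B \<noteq> {}"
  shows "residual_entropy (I \<rightarrow>\<^sub>E B) (\<lambda>v. restrict v D) = real (card (I - D)) * log 2 (card B)"
proof -
  let ?A = "I \<rightarrow>\<^sub>E B"
  have "card (fiber ?A (\<lambda>v. restrict v D) v) = card B ^ card (I - D)" if v: "v \<in> ?A" for v
  proof -
    have "w \<in> fiber ?A (\<lambda>v. restrict v D) v \<longleftrightarrow>
        w \<in> (\<Pi>\<^sub>E i\<in>I. if i \<in> D then {v i} else B)" for w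
    proof -
      have "restrict w D = restrict v D \<longleftrightarrow> (\<forall>i\<in>D. w i = v i)"
        by (auto simp: restrict_def fun_eq_iff)
      moreover have "\<forall>i\<in>D. v i \<in> B" "\<forall>i\<in>D. i \<in> I"
        using v assms(2) by (auto simp: PiE_iff)
      ultimately show ?thesis
        unfolding fiber_def PiE_iff mem_Collect_eq by (metis singleton_iff)
    qed
    then have "fiber ?A (\<lambda>v. restrict v D) v = (\<Pi>\<^sub>E i\<in>I. if i \<in> D then {v i} else B)"
      by blast
    then have "card (fiber ?A (\<lambda>v. restrict v D) v) = (\<Prod>i\<in>I. if i \<in> D then 1 else card B)"
      using assms(1) by (simp add: card_PiE if_distrib cong: prod.cong if_cong)
    also have "\<dots> = card B ^ card (I - D)"
      using assms(1) by (simp add: prod.If_cases Diff_eq Compl_eq)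
    finally show ?thesis .
  qed
  moreover have "card ?A > 0"
    using assms by (simp add: card_gt_0_iff finite_PiE PiE_eq_empty_iff)
  moreover have "card B > 0"
    using assms by (simp add: card_gt_0_iff)
  ultimately show ?thesis
    by (simp add: residual_entropy_def log_nat_power)
qed

section \<open>Cut sets of a placement\<close>

locale placement =
  fixes K N T :: nat and U :: "nat \<Rightarrow> nat set"
  assumes K: "K \<ge> 1" and placement: "dataset_placement K N U"
begin

definition holders :: "nat \<Rightarrow> nat set" where
  "holders n = {i \<in> {1..K}. n \<in> U i}"

definition confined :: "nat set \<Rightarrow> nat set" where
  "confined S = {n \<in> {1..N}. holders n \<subseteq> S}"

text \<open>The positions of all values that some user in \<open>A\<close> stores or demands.\<close>

definition cut :: "nat set \<Rightarrow> (nat \<times> nat) set" where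
  "cut A = {(q, n) \<in> {1..K} \<times> {1..N}. q \<in> A \<or> (\<exists>i\<in>A. n \<in> U i)}"

text \<open>The decoders enter the converse only through this injectivity property, which makes
  sense both for the broadcast and for the tuple of uplink messages.\<close>

definition decodable :: "(iv_array \<Rightarrow> 'b) \<Rightarrow> bool" where
  "decodable Z \<longleftrightarrow> (\<forall>k\<in>{1..K}. \<forall>v\<in>iv_arrays K T {1..N}. \<forall>w\<in>iv_arrays K T {1..N}.
     Z v = Z w \<longrightarrow> known_values K (U k) v = known_values K (U k) w \<longrightarrow>
     (\<forall>n\<in>{1..N}. v (k, n) = w (k, n)))"

abbreviation cond_on :: "(iv_array \<Rightarrow> 'b) \<Rightarrow> (nat \<times> nat) set \<Rightarrow> real" where
  "cond_on Z D \<equiv> cond_entropy (iv_arrays K T {1..N}) Z (\<lambda>v. restrict v D)"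

text \<open>The closed form of the recursion for \<open>H(S)\<close>, without the factor
  \<open>T\<close>; \<open>c = 0\<close> serves the uplink and \<open>c = 1\<close> the
  downlink.\<close>

definition excess :: "nat \<Rightarrow> nat set \<Rightarrow> real" where
  "excess c S = (\<Sum>n\<in>confined S. (real (card S) - real (card (holders n))) / real (card (holders n) + c))"

lemma U_subset: "k \<in> {1..K} \<Longrightarrow> U k \<subseteq> {1..N}"
  using placement by (auto simp: dataset_placement_def)

lemma finite_holders [simp]: "finite (holders n)"
  by (simp add: holders_def)

lemma finite_confined [simp]: "finite (confined S)"
  by (simp add: confined_def)

lemma card_holders: "n \<in> {1..N} \<Longrightarrow> card (holders n) \<in> {1..K}"
proof -
  assume "n \<in> {1..N}"
  then have "n \<in> (\<Union>k\<in>{1..K}. U k)"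
    using placement by (simp add: dataset_placement_def)
  then have "holders n \<noteq> {}"
    by (auto simp: holders_def)
  then have "card (holders n) \<ge> 1" by (simp add: Suc_le_eq card_gt_0_iff)
  moreover have "card (holders n) \<le> card {1..K}"
    by (rule card_mono) (auto simp: holders_def)
  ultimately show ?thesis by simp
qed

section \<open>Double counting and the recursion over sets of users\<close>

lemma sum_card_holders: "(\<Sum>n\<in>{1..N}. card (holders n)) = (\<Sum>k\<in>{1..K}. card (U k))"
proof -
  have "(\<Sum>n\<in>{1..N}. card (holders n)) = (\<Sum>n\<in>{1..N}. \<Sum>k | k \<in> {1..K} \<and> n \<in> U k. 1)"
    by (simp add: holders_def)
  also have "\<dots> = (\<Sum>k\<in>{1..K}. \<Sum>n | n \<in> {1..N} \<and> n \<in> U k. 1)"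
    by (rule sum.swap_restrict) auto
  also have "\<dots> = (\<Sum>k\<in>{1..K}. card (U k))"
  proof (rule sum.cong[OF refl])
    fix k assume "k \<in> {1..K}"
    then have "{n. n \<in> {1..N} \<and> n \<in> U k} = U k" using U_subset by blast
    then show "(\<Sum>n | n \<in> {1..N} \<and> n \<in> U k. 1) = card (U k)" by simp
  qed
  finally show ?thesis .
qed

text \<open>A file confined to \<open>S\<close> stays confined after removing \<open>k\<close>
  exactly if \<open>k\<close> does not hold it; exchanging sums counts the non-holders in
  \<open>S\<close>.\<close>

lemma sum_confined_remove:
  fixes g :: "nat \<Rightarrow> real"
  assumes "finite S"
  shows "(\<Sum>k\<in>S. \<Sum>n\<in>confined (S - {k}). g n)
    = (\<Sum>n\<in>confined S. (real (card S) - real (card (holders n))) * g n)"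
proof -
  have "(\<Sum>k\<in>S. \<Sum>n\<in>confined (S - {k}). g n) = (\<Sum>k\<in>S. \<Sum>n | n \<in> confined S \<and> k \<notin> holders n. g n)"
    by (intro sum.cong) (auto simp: confined_def)
  also have "\<dots> = (\<Sum>n\<in>confined S. \<Sum>k | k \<in> S \<and> k \<notin> holders n. g n)"
    using assms by (intro sum.swap_restrict) auto
  also have "\<dots> = (\<Sum>n\<in>confined S. (real (card S) - real (card (holders n))) * g n)"
  proof (rule sum.cong[OF refl])
    fix n assume "n \<in> confined S"
    then have sub: "holders n \<subseteq> S" by (simp add: confined_def)
    have "{k. k \<in> S \<and> k \<notin> holders n} = S - holders n" by blast
    then show "(\<Sum>k | k \<in> S \<and> k \<notin> holders n. g n) = (real (card S) - real (card (holders n))) * g n"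
      using sub assms by (simp add: card_Diff_subset card_mono of_nat_diff)
  qed
  finally show ?thesis .
qed

text \<open>\<open>excess\<close> solves the recursion with equality. For a file with
  \<open>j\<close> holders, adding 1 to its term for \<open>S - {k}\<close> gives
  \<open>(card S - 1 + c) / (j + c)\<close>, whose numerator no longer depends on
  \<open>j\<close>.\<close>

lemma excess_step:
  assumes S: "finite S"
  shows "(\<Sum>k\<in>S. real (card (confined (S - {k}))) + excess c (S - {k}))
    = (real (card S) - 1 + real c) * excess c S"
proof -
  let ?j = "\<lambda>n. real (card (holders n))"
  have "(\<Sum>k\<in>S. real (card (confined (S - {k}))) + excess c (S - {k}))
      = (\<Sum>k\<in>S. \<Sum>n\<in>confined (S - {k}). (real (card S) - 1 + real c) / (?j n + real c))"
  proof (rule sum.cong[OF refl])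
    fix k assume k: "k \<in> S"
    have "card S > 0" using k S by (auto simp: card_gt_0_iff)
    then have cS: "real (card (S - {k})) = real (card S) - 1"
      using k S by (simp add: of_nat_diff)
    have "real (card (confined (S - {k}))) + excess c (S - {k})
        = (\<Sum>n\<in>confined (S - {k}). 1 + (real (card S) - 1 - ?j n) / (?j n + real c))"
      by (simp add: excess_def cS sum.distrib)
    also have "\<dots> = (\<Sum>n\<in>confined (S - {k}). (real (card S) - 1 + real c) / (?j n + real c))"
    proof (rule sum.cong[OF refl])
      fix n assume "n \<in> confined (S - {k})"
      then have "?j n \<ge> 1" using card_holders[of n] by (simp add: confined_def)
      then have "?j n + real c \<noteq> 0" by linarith
      then show "1 + (real (card S) - 1 - ?j n) / (?j n + real c)
          = (real (card S) - 1 + real c) / (?j n + real c)"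
        by (simp add: field_simps)
    qed
    finally show "real (card (confined (S - {k}))) + excess c (S - {k})
      = (\<Sum>n\<in>confined (S - {k}). (real (card S) - 1 + real c) / (?j n + real c))" .
  qed
  also have "\<dots> = (real (card S) - 1 + real c) * excess c S"
    unfolding sum_confined_remove[OF S] excess_def sum_distrib_left
    by (intro sum.cong) (auto simp: field_simps)
  finally show ?thesis .
qed

text \<open>Induction on \<open>card S\<close>: the recursive inequality for \<open>h\<close> is
  compared with the equality for \<open>excess\<close> and divided by the common factor.\<close>

lemma excess_lower_bound:
  assumes nonneg: "\<And>S. S \<subseteq> {1..K} \<Longrightarrow> 0 \<le> h S"
    and step: "\<And>S. S \<subseteq> {1..K} \<Longrightarrow>
      (\<Sum>k\<in>S. t * real (card (confined (S - {k}))) + h (S - {k})) \<le> (real (card S) - 1 + real c) * h S"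
    and "S \<subseteq> {1..K}"
  shows "t * excess c S \<le> h S"
  using assms(3)
proof (induction "card S" arbitrary: S)
  case 0
  then have S: "S = {}" using finite_subset[of S "{1..K}"] by simp
  \<comment> \<open>Every file has a holder, so none is confined to the empty set.\<close>
  have "n \<notin> confined {}" for n
    using card_holders[of n] by (auto simp: confined_def)
  then have "excess c S = 0" by (auto simp: excess_def S intro: sum.neutral)
  then show ?case using nonneg[OF "0.prems"] by simp
next
  case (Suc m)
  have fin: "finite S" using Suc.prems finite_subset by blast
  have m: "real (card S) - 1 = real m" using Suc.hyps(2)[symmetric] by simp
  show ?case
  \<comment> \<open>The factor vanishes for a singleton \<open>S\<close> with \<open>c = 0\<close>,
    where division is impossible. There every confined file is held by all of \<open>S\<close>, so
    \<open>excess\<close> is zero.\<close>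
  proof (cases "m + c = 0")
    case True
    have "card (holders n) = card S" if "n \<in> confined S" for n
    proof -
      have "card (holders n) \<ge> 1" "card (holders n) \<le> card S"
        using that card_holders[of n] fin by (auto simp: confined_def card_mono)
      then show ?thesis using True Suc.hyps(2) by simp
    qed
    then have "excess c S = 0" by (auto simp: excess_def intro: sum.neutral)
    then show ?thesis using nonneg[OF Suc.prems] by simp
  next
    case False
    then have pos: "real (card S) - 1 + real c > 0" using m by (cases m) auto
    have IH: "t * excess c (S - {k}) \<le> h (S - {k})" if "k \<in> S" for k
      using Suc.hyps that Suc.prems fin by (intro Suc.hyps(1)) auto
    have "(real (card S) - 1 + real c) * (t * excess c S)
        = t * (\<Sum>k\<in>S. real (card (confined (S - {k}))) + excess c (S - {k}))"
      unfolding excess_step[OF fin] by (simp add: mult.left_commute)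
    also have "\<dots> = (\<Sum>k\<in>S. t * real (card (confined (S - {k}))) + t * excess c (S - {k}))"
      by (simp add: sum_distrib_left distrib_left)
    also have "\<dots> \<le> (\<Sum>k\<in>S. t * real (card (confined (S - {k}))) + h (S - {k}))"
      using IH by (intro sum_mono) simp
    also have "\<dots> \<le> (real (card S) - 1 + real c) * h S"
      by (rule step[OF Suc.prems])
    finally show ?thesis using pos by simp
  qed
qed

section \<open>Entropies of a uniformly random array\<close>

lemma bits_lists: "bits m = {xs. set xs \<subseteq> UNIV \<and> length xs = m}"
  by (simp add: bits_def)

lemma finite_bits [simp]: "finite (bits m)"
  unfolding bits_lists by (rule finite_lists_length_eq) simp

lemma card_bits [simp]: "card (bits m) = 2 ^ m"
  unfolding bits_lists by (subst card_lists_length_eq) simp_all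

lemma finite_arrays [simp]: "finite F \<Longrightarrow> finite (iv_arrays K T F)"
  by (simp add: iv_arrays_def finite_PiE)

lemma bits_nonempty: "bits m \<noteq> {}"
  using card_bits[of m] by (metis card.empty power_not_zero zero_neq_numeral)

lemma arrays_nonempty [simp]: "iv_arrays K T F \<noteq> {}"
  by (simp add: iv_arrays_def PiE_eq_empty_iff bits_nonempty)

lemma residual_entropy_restrict:
  assumes "D \<subseteq> {1..K} \<times> {1..N}"
  shows "residual_entropy (iv_arrays K T {1..N}) (\<lambda>v. restrict v D)
    = real T * real (card ({1..K} \<times> {1..N} - D))"
  unfolding iv_arrays_def
  by (subst residual_entropy_coordinates[OF _ assms]) (auto simp: bits_nonempty log_nat_power)

lemma restrict_eq_iff: "restrict v D = restrict w D \<longleftrightarrow> (\<forall>i\<in>D. v i = w i)"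
  by (metis restrict_apply' restrict_ext)

text \<open>Given the storage of \<open>k\<close>, \<open>Z\<close> reveals the whole demand of
  \<open>k\<close>, so adding that demand to the condition leaves the joint information with
  \<open>Z\<close> unchanged. The newly fixed positions are those of user \<open>k\<close> on files
  held neither by \<open>k\<close> nor outside \<open>S\<close>, that is on
  \<open>confined (S - {k})\<close>, each worth \<open>T\<close> bits.\<close>

lemma cond_on_decodable:
  assumes S: "S \<subseteq> {1..K}" and k: "k \<in> S" and Z: "decodable Z"
  shows "cond_on Z (cut ({1..K} - S) \<union> {1..K} \<times> U k)
    = real T * real (card (confined (S - {k}))) + cond_on Z (cut ({1..K} - (S - {k})))"
proof -
  let ?I = "{1..K} \<times> {1..N}" and ?A = "iv_arrays K T {1..N}"
  define D where "D = cut ({1..K} - S) \<union> {1..K} \<times> U k"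
  define E where "E = cut ({1..K} - (S - {k}))"
  have kK: "k \<in> {1..K}" using S k by blast
  have E: "E = D \<union> {k} \<times> {1..N}"
    using kK U_subset[OF kK] k by (auto simp: D_def E_def cut_def)
  have I: "D \<subseteq> ?I" "E \<subseteq> ?I"
    using kK U_subset[OF kK] by (auto simp: D_def E_def cut_def)
  have "?I - D = (?I - E) \<union> {k} \<times> confined (S - {k})"
    using kK k by (auto simp: D_def E_def cut_def confined_def holders_def)
  moreover have "(?I - E) \<inter> {k} \<times> confined (S - {k}) = {}"
    using E by (auto simp: confined_def)
  ultimately have "card (?I - D) = card (?I - E) + card (confined (S - {k}))"
    by (simp add: card_Un_disjoint card_cartesian_product)
  then have 1: "residual_entropy ?A (\<lambda>v. restrict v D)
      = residual_entropy ?A (\<lambda>v. restrict v E) + real T * real (card (confined (S - {k})))"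
    unfolding residual_entropy_restrict[OF I(1)] residual_entropy_restrict[OF I(2)]
    by (simp add: distrib_left)
  \<comment> \<open>Decodability enters here: \<open>E\<close> adds to \<open>D\<close> only the
    demand of \<open>k\<close>.\<close>
  have 2: "residual_entropy ?A (\<lambda>v. (Z v, restrict v D)) = residual_entropy ?A (\<lambda>v. (Z v, restrict v E))"
  proof (rule residual_entropy_cong)
    fix v w assume vw: "v \<in> ?A" "w \<in> ?A"
    show "(Z v, restrict v D) = (Z w, restrict w D) \<longleftrightarrow> (Z v, restrict v E) = (Z w, restrict w E)"
    proof
      assume *: "(Z v, restrict v D) = (Z w, restrict w D)"
      then have eq: "\<forall>i\<in>D. v i = w i" by (simp add: restrict_eq_iff)
      then have "known_values K (U k) v = known_values K (U k) w"
        unfolding known_values_def restrict_eq_iff D_def by blast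
      then have "\<forall>n\<in>{1..N}. v (k, n) = w (k, n)"
        using Z vw kK * unfolding decodable_def by blast
      then show "(Z v, restrict v E) = (Z w, restrict w E)"
        using * eq by (auto simp: restrict_eq_iff E)
    next
      assume "(Z v, restrict v E) = (Z w, restrict w E)"
      then show "(Z v, restrict v D) = (Z w, restrict w D)"
        by (auto simp: restrict_eq_iff E)
    qed
  qed simp
  show ?thesis
    using 1 2 by (simp add: cond_entropy_def D_def E_def)
qed

lemma cut_empty: "cut {} = {}"
  by (auto simp: cut_def)

lemma cond_on_empty_le:
  assumes "Z ` iv_arrays K T {1..N} \<subseteq> B" "finite B"
  shows "cond_on Z (cut {}) \<le> log 2 (card B)"
proof -
  let ?A = "iv_arrays K T {1..N}"
  have "fiber ?A (\<lambda>v. restrict v {}) x = ?A" for x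
    by (auto simp: fiber_def)
  then have 1: "residual_entropy ?A (\<lambda>v. restrict v {}) = log 2 (card ?A)"
    unfolding residual_entropy_def by (simp add: card_eq_0_iff)
  have "residual_entropy ?A (\<lambda>v. (Z v, restrict v {})) = residual_entropy ?A Z"
    by (rule residual_entropy_cong) (auto simp: restrict_eq_iff)
  then have "cond_on Z (cut {}) \<le> log 2 (card (Z ` ?A))"
    using log2_card_minus_residual_entropy_le[of ?A Z]
    unfolding cond_entropy_def cut_empty 1 by simp
  also have "\<dots> \<le> log 2 (card B)"
  proof -
    have "card (Z ` ?A) \<le> card B" using assms by (intro card_mono) auto
    moreover have "card (Z ` ?A) > 0" by (simp add: card_gt_0_iff)
    ultimately show ?thesis by simp
  qed
  finally show ?thesis .
qed

text \<open>The recursion is applied to the entropy of \<open>Z\<close> given the cut of the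
  complement of \<open>S\<close>. Revealing the storage of \<open>k\<close> does not increase it,
  and summing over \<open>k\<close> gives the factor \<open>card S\<close>, hence
  \<open>c = 1\<close>.\<close>

lemma downlink_bound:
  assumes Z: "decodable Z" and B: "Z ` iv_arrays K T {1..N} \<subseteq> bits l"
  shows "real T * excess 1 {1..K} \<le> real l"
proof -
  have "real T * excess 1 {1..K} \<le> cond_on Z (cut ({1..K} - {1..K}))"
  proof (rule excess_lower_bound[where h = "\<lambda>S. cond_on Z (cut ({1..K} - S))"])
    fix S assume S: "S \<subseteq> {1..K}"
    have step: "real T * real (card (confined (S - {k}))) + cond_on Z (cut ({1..K} - (S - {k})))
        \<le> cond_on Z (cut ({1..K} - S))" if "k \<in> S" for k
      unfolding cond_on_decodable[OF S that Z, symmetric]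
      by (rule cond_entropy_antimono) (auto simp: restrict_eq_iff)
    have "(\<Sum>k\<in>S. real T * real (card (confined (S - {k}))) + cond_on Z (cut ({1..K} - (S - {k}))))
        \<le> real (card S) * cond_on Z (cut ({1..K} - S))"
      by (rule sum_bounded_above[OF step])
    then show "(\<Sum>k\<in>S. real T * real (card (confined (S - {k}))) + cond_on Z (cut ({1..K} - (S - {k}))))
        \<le> (real (card S) - 1 + real 1) * cond_on Z (cut ({1..K} - S))"
      by simp
  qed (simp_all add: cond_entropy_nonneg)
  also have "\<dots> = cond_on Z (cut {})" by simp
  also have "\<dots> \<le> log 2 (card (bits l))"
    by (rule cond_on_empty_le[OF B]) simp
  finally show ?thesis by simp
qed

text \<open>As for the downlink, but the storage of \<open>k\<close> also fixes message
  \<open>k\<close>, so its entropy can be subtracted in each step. These entropies sum to at least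
  that of all of \<open>W\<close>, which lowers the factor to \<open>card S - 1\<close>, hence
  \<open>c = 0\<close>.\<close>

lemma uplink_bound:
  fixes W :: "iv_array \<Rightarrow> nat \<Rightarrow> bool list"
  assumes Z: "decodable W"
    and W: "W ` iv_arrays K T {1..N} \<subseteq> (\<Pi>\<^sub>E k\<in>{1..K}. bits (l k))"
    and local: "\<And>v w k. v \<in> iv_arrays K T {1..N} \<Longrightarrow> w \<in> iv_arrays K T {1..N} \<Longrightarrow> k \<in> {1..K} \<Longrightarrow>
      known_values K (U k) v = known_values K (U k) w \<Longrightarrow> W v k = W w k"
  shows "real T * excess 0 {1..K} \<le> (\<Sum>k=1..K. real (l k))"
proof -
  let ?A = "iv_arrays K T {1..N}"
  \<comment> \<open>The message tuples are extensional, so agreement on \<open>{1..K}\<close> is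
    equality.\<close>
  have ext: "W v = W w" if "v \<in> ?A" "w \<in> ?A" "\<And>k. k \<in> {1..K} \<Longrightarrow> W v k = W w k" for v w
    by (rule PiE_ext[of _ "{1..K}" "\<lambda>k. bits (l k)"]) (use that W in blast)+
  have "real T * excess 0 {1..K} \<le> cond_on W (cut ({1..K} - {1..K}))"
  proof (rule excess_lower_bound[where h = "\<lambda>S. cond_on W (cut ({1..K} - S))"])
    fix S assume S: "S \<subseteq> {1..K}"
    let ?D = "cut ({1..K} - S)" and ?H = "cond_on W (cut ({1..K} - S))"
    have finS: "finite S" using S finite_subset by blast
    have step: "real T * real (card (confined (S - {k}))) + cond_on W (cut ({1..K} - (S - {k})))
        \<le> ?H - cond_on (\<lambda>v. W v k) ?D" if k: "k \<in> S" for k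
    proof -
      have "?H = cond_on (\<lambda>v. W v k) ?D + cond_entropy ?A W (\<lambda>v. (W v k, restrict v ?D))"
        by (rule cond_entropy_chain) auto
      moreover have "cond_on W (?D \<union> {1..K} \<times> U k) \<le> cond_entropy ?A W (\<lambda>v. (W v k, restrict v ?D))"
      proof (rule cond_entropy_antimono)
        fix v w assume vw: "v \<in> ?A" "w \<in> ?A"
          and eq: "restrict v (?D \<union> {1..K} \<times> U k) = restrict w (?D \<union> {1..K} \<times> U k)"
        have "known_values K (U k) v = known_values K (U k) w"
          using eq unfolding known_values_def restrict_eq_iff by blast
        then have "W v k = W w k" using local vw k S by blast
        then show "(W v k, restrict v ?D) = (W w k, restrict w ?D)"
          using eq by (auto simp: restrict_eq_iff)
      qed simp
      ultimately show ?thesis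
        unfolding cond_on_decodable[OF S k Z] by linarith
    qed
    \<comment> \<open>Users outside \<open>S\<close> have all their storage inside
      \<open>?D\<close>, so their messages carry no further information.\<close>
    have "residual_entropy ?A (\<lambda>v. (W v, restrict v ?D))
        = residual_entropy ?A (\<lambda>v. (restrict (W v) S, restrict v ?D))"
    proof (rule residual_entropy_cong)
      fix v w assume vw: "v \<in> ?A" "w \<in> ?A"
      show "(W v, restrict v ?D) = (W w, restrict w ?D)
        \<longleftrightarrow> (restrict (W v) S, restrict v ?D) = (restrict (W w) S, restrict w ?D)"
      proof
        assume *: "(restrict (W v) S, restrict v ?D) = (restrict (W w) S, restrict w ?D)"
        have "W v k = W w k" if k: "k \<in> {1..K}" for k
        proof (cases "k \<in> S")
          case True
          then show ?thesis using * by (simp add: restrict_eq_iff)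
        next
          case False
          then have "{1..K} \<times> U k \<subseteq> ?D"
            using k U_subset[OF k] by (auto simp: cut_def)
          then have "known_values K (U k) v = known_values K (U k) w"
            using * unfolding known_values_def Pair_inject prod.inject restrict_eq_iff by blast
          then show ?thesis using local vw k by blast
        qed
        then show "(W v, restrict v ?D) = (W w, restrict w ?D)"
          using ext vw * by blast
      qed auto
    qed simp
    then have "?H = cond_on (\<lambda>v. restrict (W v) S) ?D"
      by (simp only: cond_entropy_def)
    also have "\<dots> \<le> (\<Sum>k\<in>S. cond_on (\<lambda>v. W v k) ?D)"
      by (rule cond_entropy_restrict_le_sum) (use finS in simp_all)
    finally have sub: "?H \<le> (\<Sum>k\<in>S. cond_on (\<lambda>v. W v k) ?D)" .
    have "(\<Sum>k\<in>S. real T * real (card (confined (S - {k}))) + cond_on W (cut ({1..K} - (S - {k}))))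
        \<le> (\<Sum>k\<in>S. ?H - cond_on (\<lambda>v. W v k) ?D)"
      by (rule sum_mono[OF step])
    also have "\<dots> \<le> real (card S) * ?H - ?H"
      using sub by (simp add: sum_subtractf)
    finally show "(\<Sum>k\<in>S. real T * real (card (confined (S - {k}))) + cond_on W (cut ({1..K} - (S - {k}))))
        \<le> (real (card S) - 1 + real 0) * ?H"
      by (simp add: left_diff_distrib)
  qed (simp_all add: cond_entropy_nonneg)
  also have "\<dots> = cond_on W (cut {})" by simp
  also have "\<dots> \<le> log 2 (card (\<Pi>\<^sub>E k\<in>{1..K}. bits (l k)))"
    by (rule cond_on_empty_le[OF W]) (auto intro: finite_PiE)
  also have "\<dots> = (\<Sum>k=1..K. real (l k))"
    by (simp add: card_PiE power_sum[symmetric])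
  finally show ?thesis .
qed

section \<open>Entropy bounds for valid schemes\<close>

lemma scheme_decodable:
  assumes "valid_shuffling_scheme K N T U lu \<psi> ld \<rho> \<delta>"
  shows "decodable (\<lambda>v. \<rho> (uplink_messages K U \<psi> v))"
  unfolding decodable_def
proof (intro ballI impI)
  fix k v w n assume *: "k \<in> {1..K}" "v \<in> iv_arrays K T {1..N}" "w \<in> iv_arrays K T {1..N}" "n \<in> {1..N}"
    and "\<rho> (uplink_messages K U \<psi> v) = \<rho> (uplink_messages K U \<psi> w)"
    and "known_values K (U k) v = known_values K (U k) w"
  then show "v (k, n) = w (k, n)"
    using assms unfolding valid_shuffling_scheme_def by metis
qed

lemma scheme_uplink_range:
  assumes "valid_shuffling_scheme K N T U lu \<psi> ld \<rho> \<delta>" "v \<in> iv_arrays K T {1..N}"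
  shows "uplink_messages K U \<psi> v \<in> (\<Pi>\<^sub>E k\<in>{1..K}. bits (lu k))"
  unfolding uplink_messages_def
proof (rule restrict_PiE_iff[THEN iffD2], rule ballI)
  fix k assume k: "k \<in> {1..K}"
  have "known_values K (U k) v \<in> iv_arrays K T (U k)"
    using assms(2) U_subset[OF k] by (auto simp: known_values_def iv_arrays_def PiE_iff)
  then show "\<psi> k (known_values K (U k) v) \<in> bits (lu k)"
    using assms(1) k unfolding valid_shuffling_scheme_def by blast
qed

lemma scheme_bounds:
  assumes "valid_shuffling_scheme K N T U lu \<psi> ld \<rho> \<delta>"
  shows "real T * excess 0 {1..K} \<le> (\<Sum>k=1..K. real (lu k))" "real T * excess 1 {1..K} \<le> real ld"
proof -
  \<comment> \<open>Equal uplink tuples yield equal broadcasts, so decodability passes from the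
    broadcast to the tuple.\<close>
  have "decodable (uplink_messages K U \<psi>)"
    using scheme_decodable[OF assms] unfolding decodable_def by presburger
  then show "real T * excess 0 {1..K} \<le> (\<Sum>k=1..K. real (lu k))"
  proof (rule uplink_bound)
    show "uplink_messages K U \<psi> ` iv_arrays K T {1..N} \<subseteq> (\<Pi>\<^sub>E k\<in>{1..K}. bits (lu k))"
      using scheme_uplink_range[OF assms] by blast
    fix v w k assume "k \<in> {1..K}" "known_values K (U k) v = known_values K (U k) w"
    then show "uplink_messages K U \<psi> v k = uplink_messages K U \<psi> w k"
      by (simp only: uplink_messages_def restrict_apply')
  qed
  show "real T * excess 1 {1..K} \<le> real ld"
  proof (rule downlink_bound[OF scheme_decodable[OF assms]])
    show "(\<lambda>v. \<rho> (uplink_messages K U \<psi> v)) ` iv_arrays K T {1..N} \<subseteq> bits ld"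
      using scheme_uplink_range[OF assms] assms
      unfolding valid_shuffling_scheme_def by (meson Pi_mem image_subsetI)
  qed
qed

lemma excess_all:
  "excess c {1..K} = (\<Sum>n\<in>{1..N}. (real K - real (card (holders n))) / real (card (holders n) + c))"
  unfolding excess_def by (rule sum.cong) (auto simp: confined_def holders_def)

end

section \<open>Envelopes over the storage grid\<close>

lemma storage_gridI: "j \<in> {1..K} \<Longrightarrow> real j / real K \<in> storage_grid K"
  by (auto simp: storage_grid_def)

lemma lower_convex_envelope_storage_grid:
  fixes f :: "real \<Rightarrow> real"
  assumes "K \<ge> 1"
  defines "L \<equiv> lower_convex_envelope ((\<lambda>s. (s, f s)) ` storage_grid K)"
  shows "convex_on {1 / real K..1} L"
    and "s \<in> storage_grid K \<Longrightarrow> L s \<le> f s"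
    and "convex_on {1 / real K..1} g \<Longrightarrow> (\<And>s. s \<in> storage_grid K \<Longrightarrow> g s \<le> f s) \<Longrightarrow>
      x \<in> {1 / real K..1} \<Longrightarrow> g x \<le> L x"
proof -
  let ?P = "(\<lambda>s. (s, f s)) ` storage_grid K"
  have P: "finite ?P" "?P \<noteq> {}"
    using assms(1) by (auto simp: storage_grid_def)
  note I = spanned_interval_storage_grid[OF assms(1), of f]
  have L: "L \<in> convex_minorants ?P"
    unfolding L_def by (rule lower_convex_envelope_minorant[OF P])
  then show "convex_on {1 / real K..1} L" and "s \<in> storage_grid K \<Longrightarrow> L s \<le> f s"
    unfolding convex_minorants_def I by auto
  assume "convex_on {1 / real K..1} g" "\<And>s. s \<in> storage_grid K \<Longrightarrow> g s \<le> f s" "x \<in> {1 / real K..1}"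
  then show "g x \<le> L x"
    unfolding L_def by (intro lower_convex_envelope_upper[OF P]) (auto simp: convex_minorants_def I)
qed

text \<open>\<open>y\<close> is a convex combination of \<open>x\<close> and \<open>b\<close>, and
  the value at \<open>b\<close> contributes nothing positive.\<close>

lemma convex_on_antimono:
  fixes g :: "real \<Rightarrow> real"
  assumes g: "convex_on {a..b} g" "0 \<le> g x" "g b \<le> 0" and xy: "a \<le> x" "x \<le> y" "y \<le> b"
  shows "g y \<le> g x"
proof -
  have "y \<in> closed_segment x b"
    using xy by (simp add: closed_segment_eq_real_ivl)
  then obtain t where t: "0 \<le> t" "t \<le> 1" "y = (1 - t) *\<^sub>R x + t *\<^sub>R b"
    by (auto simp: in_segment)
  have "g y \<le> (1 - t) * g x + t * g b"
    unfolding t(3) by (rule convex_onD[OF g(1)]) (use t xy in auto)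
  also have "\<dots> \<le> 1 * g x + 0"
    using g t by (intro add_mono mult_right_mono mult_nonneg_nonpos) auto
  finally show ?thesis by simp
qed

text \<open>The mean \<open>?x\<close> of the points \<open>j n / K\<close> is at most
  \<open>\<mu>\<close>. Monotonicity moves from \<open>\<mu>\<close> to \<open>?x\<close>, Jensen's
  inequality passes to the grid points, and there the envelope lies below \<open>f\<close>.\<close>

lemma lower_convex_envelope_le_average:
  fixes f :: "real \<Rightarrow> real"
  assumes K: "K \<ge> 1" and N: "finite A" "A \<noteq> {}"
    and nonneg: "\<And>s. s \<in> storage_grid K \<Longrightarrow> 0 \<le> f s" and f1: "f 1 = 0"
    and j: "\<And>n. n \<in> A \<Longrightarrow> j n \<in> {1..K}"
    and sum: "(\<Sum>n\<in>A. real (j n)) \<le> \<mu> * real K * real (card A)"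
    and \<mu>: "\<mu> \<le> 1"
  shows "lower_convex_envelope ((\<lambda>s. (s, f s)) ` storage_grid K) \<mu>
    \<le> (\<Sum>n\<in>A. f (real (j n) / real K)) / real (card A)"
proof -
  define L where "L = lower_convex_envelope ((\<lambda>s. (s, f s)) ` storage_grid K)"
  note env = lower_convex_envelope_storage_grid[OF K, where f = f, folded L_def]
  let ?I = "{1 / real K..1}"
  let ?x = "\<Sum>n\<in>A. (1 / real (card A)) *\<^sub>R (real (j n) / real K)"
  have cA: "real (card A) > 0" using N by (simp add: card_gt_0_iff)
  have K0: "real K > 0" using K by simp
  have mem: "real (j n) / real K \<in> ?I" if "n \<in> A" for n
    using j[OF that] K0 by (simp add: field_simps)
  have x: "?x \<in> ?I"
    by (rule convex_sum) (use N cA mem in auto)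
  have "?x = (\<Sum>n\<in>A. real (j n)) / (real K * real (card A))"
    by (simp add: sum_divide_distrib mult.commute)
  also have "\<dots> \<le> \<mu>"
    using sum K0 cA by (simp add: pos_divide_le_eq mult.assoc)
  finally have "?x \<le> \<mu>" .
  have "L \<mu> \<le> L ?x"
  proof (rule convex_on_antimono[OF env(1)])
    \<comment> \<open>The zero function is a convex minorant.\<close>
    show "0 \<le> L ?x"
      by (rule env(3)[where g = "\<lambda>_. 0"]) (use nonneg x in \<open>auto simp: convex_on_const\<close>)
    show "L 1 \<le> 0"
      using env(2)[where s = 1] storage_gridI[of K K] K f1 by simp
  qed (use x \<open>?x \<le> \<mu>\<close> \<mu> in auto)
  also have "L ?x \<le> (\<Sum>n\<in>A. 1 / real (card A) * L (real (j n) / real K))"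
    by (rule convex_on_sum[OF N env(1)]) (use cA mem in auto)
  also have "\<dots> \<le> (\<Sum>n\<in>A. 1 / real (card A) * f (real (j n) / real K))"
    using j by (intro sum_mono mult_left_mono env(2) storage_gridI) auto
  also have "\<dots> = (\<Sum>n\<in>A. f (real (j n) / real K)) / real (card A)"
    by (simp add: sum_divide_distrib)
  finally show ?thesis by (simp add: L_def)
qed

text \<open>The rate \<open>(K - j) / (j + c)\<close> as a function of \<open>s = j / K\<close>; the uplink has \<open>c = 0\<close>, the downlink \<open>c = 1\<close>.\<close>

definition rate :: "nat \<Rightarrow> nat \<Rightarrow> real \<Rightarrow> real" where
  "rate K c s = (real K - s * real K) / (s * real K + real c)"

lemma rate_0: "K \<ge> 1 \<Longrightarrow> 0 < s \<Longrightarrow> 1 / s - 1 = rate K 0 s"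
  by (simp add: rate_def field_simps)

lemma rate_1: "K \<ge> 1 \<Longrightarrow> 0 < s \<Longrightarrow> s * real K / (s * real K + 1) * (1 / s - 1) = rate K 1 s"
  by (simp add: rate_def divide_simps) (simp add: algebra_simps)

text \<open>The derivative \<open>- K (K + c) / (s K + c)^2\<close> increases with \<open>s\<close>.
  Convexity makes \<open>rate\<close> itself a minorant of its grid points.\<close>

lemma convex_on_rate:
  assumes "K \<ge> 1"
  shows "convex_on {1 / real K..1} (rate K c)"
proof (rule convex_on_realI)
  have K0: "real K > 0" using assms by simp
  have pos: "s * real K + real c > 0" if "s \<in> {1 / real K..1}" for s
  proof -
    have "s > 0" using that K0 by (auto intro: less_le_trans[of 0 "1 / real K"])
    then show ?thesis using K0 by (simp add: add_pos_nonneg)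
  qed
  show "(rate K c has_real_derivative - (real K * (real K + real c)) / (s * real K + real c)^2) (at s)"
    if "s \<in> {1 / real K..1}" for s
  proof -
    have "s * real K + real c \<noteq> 0" using pos[OF that] by simp
    then have "(rate K c has_real_derivative
        (- real K * (s * real K + real c) - (real K - s * real K) * real K) /
        ((s * real K + real c) * (s * real K + real c))) (at s)"
      unfolding rate_def by (auto intro!: derivative_eq_intros)
    moreover have "- real K * (s * real K + real c) - (real K - s * real K) * real K
        = - (real K * (real K + real c))"
      by (simp add: algebra_simps)
    ultimately show ?thesis by (simp only: power2_eq_square)
  qed
  show "- (real K * (real K + real c)) / (s * real K + real c)^2
      \<le> - (real K * (real K + real c)) / (t * real K + real c)^2"
    if "s \<in> {1 / real K..1}" "t \<in> {1 / real K..1}" "s \<le> t" for s t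
    unfolding divide_minus_left neg_le_iff_le
    using pos[OF that(1)] pos[OF that(2)] that(3) K0
    by (intro divide_left_mono power_mono mult_pos_pos) (auto intro: mult_right_mono)
qed simp

lemma storage_grid_pos: "s \<in> storage_grid K \<Longrightarrow> 0 < s"
  by (auto simp: storage_grid_def)

lemma Conv_u_rate:
  "K \<ge> 1 \<Longrightarrow> Conv_u K = lower_convex_envelope ((\<lambda>s. (s, rate K 0 s)) ` storage_grid K)"
  unfolding Conv_u_def
  by (intro arg_cong[where f = lower_convex_envelope] image_cong) (auto simp: rate_0 storage_grid_pos)

lemma Conv_d_rate:
  "K \<ge> 1 \<Longrightarrow> Conv_d K = lower_convex_envelope ((\<lambda>s. (s, rate K 1 s)) ` storage_grid K)"
  unfolding Conv_d_def
  by (intro arg_cong[where f = lower_convex_envelope] image_cong refl)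
    (simp only: rate_1 storage_grid_pos)

text \<open>By double counting, the holder counts sum to at most \<open>\<mu> K N\<close>;
  \<open>excess\<close> on all users, divided by \<open>N\<close>, is the average rate over the
  files.\<close>

lemma (in placement) envelope_le_excess:
  assumes N: "N \<ge> 1" and \<mu>: "\<mu> \<le> 1" and card: "\<forall>k\<in>{1..K}. real (card (U k)) \<le> \<mu> * real N"
  shows "lower_convex_envelope ((\<lambda>s. (s, rate K c s)) ` storage_grid K) \<mu> \<le> excess c {1..K} / real N"
proof -
  have "(\<Sum>n\<in>{1..N}. real (card (holders n))) = (\<Sum>k\<in>{1..K}. real (card (U k)))"
    using sum_card_holders by (metis of_nat_sum)
  also have "\<dots> \<le> \<mu> * real K * real (card {1..N})"
    using sum_bounded_above[of "{1..K}" "\<lambda>k. real (card (U k))" "\<mu> * real N"] card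
    by (simp add: mult.left_commute mult.assoc)
  finally have "lower_convex_envelope ((\<lambda>s. (s, rate K c s)) ` storage_grid K) \<mu>
      \<le> (\<Sum>n\<in>{1..N}. rate K c (real (card (holders n)) / real K)) / real (card {1..N})"
  proof (rule lower_convex_envelope_le_average[OF K, rotated 5])
    show "0 \<le> rate K c s" if "s \<in> storage_grid K" for s
      using that K by (auto simp: storage_grid_def rate_def)
  qed (use N \<mu> card_holders in \<open>auto simp: rate_def\<close>)
  also have "\<dots> = excess c {1..K} / real N"
    unfolding excess_all using K by (simp add: rate_def)
  finally show ?thesis .
qed

theorem theorem3:
  fixes K N T :: nat and \<mu> :: real
    and U :: "nat \<Rightarrow> nat set"
    and lu :: "nat \<Rightarrow> nat" and \<psi> :: "nat \<Rightarrow> iv_array \<Rightarrow> bool list"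
    and ld :: nat and \<rho> :: "(nat \<Rightarrow> bool list) \<Rightarrow> bool list"
    and \<delta> :: "nat \<Rightarrow> bool list \<Rightarrow> iv_array \<Rightarrow> nat \<Rightarrow> bool list"
  assumes "K \<ge> 1" and "N \<ge> 1" and "T \<ge> 1"
    and "1 / real K \<le> \<mu>" and "\<mu> \<le> 1"
    and "dataset_placement K N U"
    and "\<forall>k\<in>{1..K}. real (card (U k)) \<le> \<mu> * real N"
    and "valid_shuffling_scheme K N T U lu \<psi> ld \<rho> \<delta>"
  shows "uplink_load K N T lu \<ge> Conv_u K \<mu> \<and>
         downlink_load N T ld \<ge> Conv_d K \<mu> \<and>
         (\<mu> * real K \<in> \<int> \<longrightarrow>
            uplink_load K N T lu \<ge> 1 / \<mu> - 1 \<and>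
            downlink_load N T ld \<ge> \<mu> * real K / (\<mu> * real K + 1) * (1 / \<mu> - 1))"
proof -
  interpret placement K N T U
    by unfold_locales (fact assms)+
  have NT: "real N > 0" "real T > 0" using assms by auto
  have \<mu>: "0 < \<mu>" "\<mu> \<in> {1 / real K..1}"
    using assms by (auto intro: less_le_trans[of 0 "1 / real K"])
  have up: "excess 0 {1..K} / real N \<le> uplink_load K N T lu"
    using scheme_bounds(1)[OF assms(8)] NT by (simp add: uplink_load_def field_simps)
  have down: "excess 1 {1..K} / real N \<le> downlink_load N T ld"
    using scheme_bounds(2)[OF assms(8)] NT by (simp add: downlink_load_def field_simps)
  have u: "Conv_u K \<mu> \<le> uplink_load K N T lu"
    unfolding Conv_u_rate[OF assms(1)] using envelope_le_excess[OF assms(2,5,7), of 0] up by linarith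
  have d: "Conv_d K \<mu> \<le> downlink_load N T ld"
    unfolding Conv_d_rate[OF assms(1)] using envelope_le_excess[OF assms(2,5,7), of 1] down by linarith
  \<comment> \<open>The explicit bound is the value at \<open>\<mu>\<close> of the convex minorant
    \<open>rate K 0\<close>, so it lies below the envelope; likewise with \<open>rate K 1\<close>
    for the downlink.\<close>
  have "1 / \<mu> - 1 \<le> Conv_u K \<mu>"
    unfolding Conv_u_rate[OF assms(1)] rate_0[OF assms(1) \<mu>(1)]
    by (rule lower_convex_envelope_storage_grid(3)[OF assms(1) convex_on_rate[OF assms(1)] _ \<mu>(2)]) simp
  moreover have "\<mu> * real K / (\<mu> * real K + 1) * (1 / \<mu> - 1) \<le> Conv_d K \<mu>"
    unfolding Conv_d_rate[OF assms(1)] rate_1[OF assms(1) \<mu>(1)]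
    by (rule lower_convex_envelope_storage_grid(3)[OF assms(1) convex_on_rate[OF assms(1)] _ \<mu>(2)]) simp
  ultimately show ?thesis
    using u d by linarith
qed

end
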